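(* Let $r$ be a complex number and $n\ge1$ an integer. Then, as polynomials in $x,y$, $$2(1+x+y)\sum_{k=0}^{n-1}\frac{(2r+k+1)\cdots(2r+n)}{(k+1)\cdots n}d_k^{(r)}(x)d_k^{(r)}(y)=(n+2r)\big(d_n^{(r)}(x)d_{n-1}^{(r)}(y)+d_{n-1}^{(r)}(x)d_n^{(r)}(y)\big).$$
   Context: For a complex number $a$ and integer $k\ge0$, $\binom{a}{k}=a(a-1)\cdots(a-k+1)/k!$. For a parameter $r$ and an integer $n\ge 0$, $d_n^{(r)}(x)=\sum_{k=0}^n\binom{x+r+k}{k}\binom{x-r}{n-k}$. *)

theory Defs
  imports Complex_Main "HOL-Computational_Algebra.Polynomial"
begin

definition binom_poly :: "complex poly \<Rightarrow> nat \<Rightarrow> complex poly" where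
  "binom_poly p k = smult (1 / fact k) (\<Prod>i<k. p - of_nat i)"

definition d_poly :: "complex \<Rightarrow> nat \<Rightarrow> complex poly" where
  "d_poly r n = (\<Sum>k\<le>n. binom_poly [:r + of_nat k, 1:] k * binom_poly [:- r, 1:] (n - k))"

text \<open>
  Polynomials in \<open>x, y\<close> over the complex numbers are elements of \<open>(\<complex>[x])[y]\<close>: the inner variable
  is \<open>x\<close>, the outer one is \<open>y\<close>.
\<close>

type_synonym bipoly = "complex poly poly"

definition const_xy :: "complex \<Rightarrow> bipoly" where
  "const_xy c = [:[:c:]:]"

definition var_x :: bipoly where
  "var_x = [:[:0, 1:]:]"

definition var_y :: bipoly where
  "var_y = [:0, 1:]"

definition in_x :: "complex poly \<Rightarrow> bipoly" where
  "in_x p = [:p:]"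

definition in_y :: "complex poly \<Rightarrow> bipoly" where
  "in_y p = map_poly (\<lambda>c. [:c:]) p"

text \<open>The values are those of the usual formulas, with the library's generalized binomial coefficient.\<close>

lemma poly_binom_poly: "poly (binom_poly p k) x = poly p x gchoose k"
  by (simp add: binom_poly_def gbinomial_prod_rev poly_prod atLeast0LessThan)

lemma poly_d_poly:
  "poly (d_poly r n) x = (\<Sum>k\<le>n. ((x + r + of_nat k) gchoose k) * ((x - r) gchoose (n - k)))"
  by (simp add: d_poly_def poly_sum poly_binom_poly algebra_simps)

lemma eval_var_x: "poly (poly var_x [:y:]) x = x"
  by (simp add: var_x_def)

lemma eval_var_y: "poly (poly var_y [:y:]) x = y"
  by (simp add: var_y_def)

lemma eval_in_x: "poly (poly (in_x p) [:y:]) x = poly p x"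
  by (simp add: in_x_def)

lemma eval_in_y: "poly (poly (in_y p) [:y:]) x = poly p y"
  by (induction p) (simp_all add: in_y_def map_poly_pCons)

end

theory Submission
  imports Defs "HOL-Computational_Algebra.Formal_Power_Series"
begin

unbundle fps_syntax

text \<open>
  The number \<open>d\<^sub>n(x)\<close> is the coefficient of \<open>t\<^sup>n\<close> in \<open>(1 - t) powr -(x + r + 1) * (1 + t) powr (x - r)\<close>.
  The differential equation of this series is a three-term recurrence for \<open>d\<^sub>n\<close>, and the identity
  is the Christoffel--Darboux formula belonging to that recurrence.
\<close>

text \<open>If all values agree, every constant polynomial \<open>[:y:]\<close> is a root of
  \<open>p - q\<close> over the integral domain of complex polynomials in x. A nonzero polynomial
  has only finitely many roots, so \<open>p - q\<close> vanishes.\<close>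

lemma bipoly_eqI:
  fixes p q :: bipoly
  assumes "\<And>x y. poly (poly p [:y:]) x = poly (poly q [:y:]) x"
  shows "p = q"
proof (rule ccontr)
  assume "p \<noteq> q"
  then have "finite {c. poly (p - q) c = 0}"
    by (intro poly_roots_finite) simp
  moreover have "range (\<lambda>y. [:y:]) \<subseteq> {c. poly (p - q) c = 0}"
    using assms by (auto simp: poly_eq_poly_eq_iff[symmetric])
  ultimately have "finite (range (\<lambda>y::complex. [:y:]))"
    by (rule rev_finite_subset)
  moreover have "inj (\<lambda>y::complex. [:y:])"
    by (simp add: inj_def)
  ultimately show False
    using finite_imageD infinite_UNIV_char_0 by blast
qed

text \<open>The series \<open>(1 - t) powr -a\<close>.\<close>

definition fps_neg_binomial :: "'a::field_char_0 \<Rightarrow> 'a fps" where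
  "fps_neg_binomial a = Abs_fps (\<lambda>k. (a - 1 + of_nat k) gchoose k)"

text \<open>With g_k the coefficients of the series, this says (k+1) g_(k+1) = (a+k) g_k, which is
  the absorption identity for binomial coefficients.\<close>

lemma fps_neg_binomial_ODE:
  "(1 - fps_X) * fps_deriv (fps_neg_binomial a) = fps_const a * fps_neg_binomial a"
proof (rule fps_ext)
  fix k
  have step: "of_nat (Suc m) * ((a + of_nat m) gchoose Suc m) =
      (a + of_nat m) * ((a - 1 + of_nat m) gchoose m)" for m
    using gbinomial_absorption[of m "a + of_nat m"] by (simp add: algebra_simps)
  show "((1 - fps_X) * fps_deriv (fps_neg_binomial a)) $ k = (fps_const a * fps_neg_binomial a) $ k"
  proof (cases k)
    case 0
    then show ?thesis
      by (simp add: fps_neg_binomial_def left_diff_distrib)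
  next
    case (Suc m)
    then show ?thesis
      using step[of k]
      by (simp add: fps_neg_binomial_def left_diff_distrib algebra_simps)
  qed
qed

lemma fps_binomial_ODE:
  "(1 + fps_X) * fps_deriv (fps_binomial b) = fps_const b * fps_binomial (b::'a::field_char_0)"
proof (rule fps_ext)
  fix k
  show "((1 + fps_X) * fps_deriv (fps_binomial b)) $ k = (fps_const b * fps_binomial b) $ k"
    using gbinomial_mult_1[of b k] by (cases k) (simp_all add: distrib_right algebra_simps)
qed

text \<open>The defining sum is a Cauchy product; the shift by 1 in the first exponent turns
  \<open>a - 1 + of_nat k\<close> into x + r + k.\<close>

lemma poly_d_poly_fps:
  "poly (d_poly r n) x = (fps_neg_binomial (x + r + 1) * fps_binomial (x - r)) $ n"
  by (simp add: poly_d_poly fps_mult_nth fps_neg_binomial_def atLeast0AtMost)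

lemma d_poly_0: "poly (d_poly r 0) x = 1"
  by (simp add: poly_d_poly)

lemma d_poly_1: "poly (d_poly r 1) x = 1 + 2 * x"
  by (simp add: poly_d_poly)

text \<open>The generating series satisfies (1 - t^2) F' = ((a+b) + (a-b) t) F, where a + b = 1 + 2x
  and a - b = 1 + 2r. The recurrence compares the coefficients of t^(n+1).\<close>

lemma d_poly_recurrence:
  "(of_nat n + 2) * poly (d_poly r (n + 2)) x =
    (1 + 2 * x) * poly (d_poly r (n + 1)) x + (of_nat n + 1 + 2 * r) * poly (d_poly r n) x"
proof -
  define a b where "a = x + r + 1" and "b = x - r"
  define G H where "G = fps_neg_binomial a" and "H = fps_binomial b"
  define F where "F = G * H"
  have "(1 - fps_X^2) * fps_deriv F =
      (1 + fps_X) * ((1 - fps_X) * fps_deriv G) * H + (1 - fps_X) * G * ((1 + fps_X) * fps_deriv H)"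
    by (simp add: F_def power2_eq_square algebra_simps)
  also have "\<dots> = (1 + fps_X) * fps_const a * F + (1 - fps_X) * fps_const b * F"
    unfolding G_def H_def fps_neg_binomial_ODE fps_binomial_ODE F_def by (simp add: algebra_simps)
  also have "\<dots> = fps_const (a + b) * F + fps_X * (fps_const (a - b) * F)"
    by (simp add: algebra_simps flip: fps_const_add fps_const_sub)
  finally have "((1 - fps_X^2) * fps_deriv F) $ (n + 1) =
      (fps_const (a + b) * F + fps_X * (fps_const (a - b) * F)) $ (n + 1)"
    by simp
  \<comment> \<open>The term t^2 F' contributes the coefficient of F' at n - 1, which is n F_n; for
    n = 0 there is no such coefficient, and the contribution is 0.\<close>
  moreover have "((1 - fps_X^2) * fps_deriv F) $ (n + 1) = (of_nat n + 2) * F $ (n + 2) - of_nat n * F $ n"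
    by (cases n) (simp_all add: left_diff_distrib fps_X_power_mult_nth)
  ultimately have "(of_nat n + 2) * F $ (n + 2) - of_nat n * F $ n = (a + b) * F $ (n + 1) + (a - b) * F $ n"
    by simp
  moreover have "poly (d_poly r m) x = F $ m" for m
    by (simp add: poly_d_poly_fps F_def G_def H_def a_def b_def)
  ultimately show ?thesis
    by (simp add: a_def b_def algebra_simps)
qed

text \<open>The algebra of the induction step: \<open>u0\<close>, \<open>u1\<close>,
  \<open>u2\<close> and \<open>v0\<close>, \<open>v1\<close>, \<open>v2\<close> stand for
  consecutive values at x and at y. Inserting both recurrences, the terms with \<open>e\<close> give
  the old sum, and (1 + 2x) + (1 + 2y) = 2(1 + x + y) gives the new summand.\<close>

lemma christoffel_darboux_step:
  fixes c e :: "'a::field"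
  assumes "c \<noteq> 0" and "2 * (1 + x + y) * S = e * (u1 * v0 + u0 * v1)"
    and "c * u2 = (1 + 2 * x) * u1 + e * u0" and "c * v2 = (1 + 2 * y) * v1 + e * v0"
  shows "2 * (1 + x + y) * (f / c * (S + u1 * v1)) = f * (u2 * v1 + u1 * v2)"
proof -
  have "c * (u2 * v1 + u1 * v2) = (c * u2) * v1 + u1 * (c * v2)"
    by (simp add: algebra_simps)
  also have "\<dots> = 2 * (1 + x + y) * S + 2 * (1 + x + y) * (u1 * v1)"
    unfolding assms(2-4) by (simp add: algebra_simps)
  finally have "u2 * v1 + u1 * v2 = (2 * (1 + x + y) * (S + u1 * v1)) / c"
    using assms(1) by (simp add: field_simps)
  then show ?thesis
    by simp
qed

lemma d_poly_christoffel_darboux: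
  "2 * (1 + x + y) * (\<Sum>k = 0..n. (\<Prod>j = k + 1..n + 1. 2 * r + of_nat j) /
      (\<Prod>j = k + 1..n + 1. of_nat j) * poly (d_poly r k) x * poly (d_poly r k) y) =
    (of_nat n + 1 + 2 * r) * (poly (d_poly r (n + 1)) x * poly (d_poly r n) y +
      poly (d_poly r n) x * poly (d_poly r (n + 1)) y)"
proof (induction n)
  case 0
  show ?case
    using d_poly_1[of r] by (simp add: d_poly_0 algebra_simps)
next
  case (Suc n)
  define w where "w m k = (\<Prod>j = k + 1..m. 2 * r + of_nat j) / (\<Prod>j = k + 1..m. of_nat j)"
    for m k :: nat
  define D where "D k z = poly (d_poly r k) z" for k z
  define f where "f = of_nat n + 2 + 2 * r"
  define c :: complex where "c = of_nat n + 2"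
  have c: "c \<noteq> 0"
    unfolding c_def by (metis of_nat_add of_nat_eq_0_iff of_nat_numeral add_is_0 zero_neq_numeral)
  \<comment> \<open>Raising the upper limit appends the factor j = n + 2, so all weights are
    rescaled by the same \<open>f / c\<close>. This includes k = n + 1, where the old products are
    empty and the old weight is 1.\<close>
  have w: "w (n + 2) k = f / c * w (n + 1) k" if "k \<le> n + 1" for k
    using that by (simp add: w_def f_def c_def prod.nat_ivl_Suc' algebra_simps)
  have "(\<Sum>k = 0..n + 1. w (n + 2) k * D k x * D k y) =
      (\<Sum>k = 0..n + 1. f / c * (w (n + 1) k * D k x * D k y))"
    by (intro sum.cong refl) (simp only: w atLeastAtMost_iff mult.assoc)
  also have "\<dots> = f / c * ((\<Sum>k = 0..n. w (n + 1) k * D k x * D k y) + D (n + 1) x * D (n + 1) y)"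
    by (simp add: sum_distrib_left[symmetric] w_def del: times_divide_eq_left)
  finally have sum: "(\<Sum>k = 0..n + 1. w (n + 2) k * D k x * D k y) =
      f / c * ((\<Sum>k = 0..n. w (n + 1) k * D k x * D k y) + D (n + 1) x * D (n + 1) y)" .
  have "2 * (1 + x + y) * (\<Sum>k = 0..n + 1. w (n + 2) k * D k x * D k y) =
      f * (D (n + 2) x * D (n + 1) y + D (n + 1) x * D (n + 2) y)"
    unfolding sum
  proof (rule christoffel_darboux_step[OF c])
    show "2 * (1 + x + y) * (\<Sum>k = 0..n. w (n + 1) k * D k x * D k y) =
        (of_nat n + 1 + 2 * r) * (D (n + 1) x * D n y + D n x * D (n + 1) y)"
      using Suc.IH by (simp only: w_def D_def)
  qed (simp_all only: c_def D_def d_poly_recurrence)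
  then show ?case
    by (simp add: w_def D_def f_def algebra_simps)
qed

theorem theorem2p8:
  fixes r :: complex and n :: nat
  assumes "n \<ge> 1"
  shows "2 * (1 + var_x + var_y) *
      (\<Sum>k = 0..n - 1.
         const_xy ((\<Prod>j = k + 1..n. 2 * r + of_nat j) / (\<Prod>j = k + 1..n. of_nat j)) *
         in_x (d_poly r k) * in_y (d_poly r k)) =
    const_xy (of_nat n + 2 * r) *
      (in_x (d_poly r n) * in_y (d_poly r (n - 1)) + in_x (d_poly r (n - 1)) * in_y (d_poly r n))"
proof (rule bipoly_eqI)
  fix x y :: complex
  obtain m where n: "n = m + 1"
    using assms by (metis add.commute le_Suc_ex)
  have const: "poly (poly (const_xy c) [:y:]) x = c" for c
    by (simp add: const_xy_def)
  have two: "poly (poly 2 [:y:]) x = (2::complex)"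
    by (metis poly_numeral)
  show "poly (poly (2 * (1 + var_x + var_y) *
      (\<Sum>k = 0..n - 1.
         const_xy ((\<Prod>j = k + 1..n. 2 * r + of_nat j) / (\<Prod>j = k + 1..n. of_nat j)) *
         in_x (d_poly r k) * in_y (d_poly r k))) [:y:]) x =
    poly (poly (const_xy (of_nat n + 2 * r) *
      (in_x (d_poly r n) * in_y (d_poly r (n - 1)) + in_x (d_poly r (n - 1)) * in_y (d_poly r n))) [:y:]) x"
    using d_poly_christoffel_darboux[of x y r m]
    unfolding n by (simp only: poly_mult poly_add poly_1 poly_sum const two eval_var_x eval_var_y
      eval_in_x eval_in_y add_diff_cancel_right' of_nat_add of_nat_1)
qed

end
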